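(* Let $G$ be a finite group. Then the following hold: (i) the graph $\overline{\mathcal{P}_E(G)}$ is bipartite if and only if $G$ is cyclic; (ii) the girth of $\overline{\mathcal{P}_E(G)}$ is either $3$ or $\infty$; (iii) the graph $\overline{\mathcal{P}_E(G)}$ is weakly perfect.
   Context: The enhanced power graph $\mathcal{P}_E(G)$ of a group $G$ is the simple undirected graph with vertex set $G$ in which two distinct vertices $x,y$ are adjacent if $x,y\in\langle z\rangle$ for some $z\in G$. Its complement $\overline{\mathcal{P}_E(G)}$ has the same vertex set $G$, and distinct $x,y$ are adjacent in it if and only if they are not adjacent in $\mathcal{P}_E(G)$. The girth of a graph is the length of a shortest cycle, and is $\infty$ if there is no cycle. A graph $\Gamma$ is weakly perfect if its clique number equals its chromatic number, $\omega(\Gamma)=\chi(\Gamma)$. A graph is bipartite if its vertex set can be partitioned into two (possibly empty) sets such that no two vertices in the same set are adjacent. *)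

theory Defs
  imports "HOL-Algebra.Elementary_Groups" "HOL-Library.Ramsey" "HOL-Library.Extended_Nat"
begin

text \<open>
  A simple undirected graph is a pair \<open>(V, E)\<close> of a vertex set and a set of edges, an edge
  being a two-element subset of \<open>V\<close>. This is the edge representation for which
  \<^const>\<open>clique\<close> and \<^const>\<open>indep\<close> are defined in \<^theory>\<open>HOL-Library.Ramsey\<close>.
\<close>

type_synonym 'a ugraph = "'a set \<times> 'a set set"

abbreviation uverts :: "'a ugraph \<Rightarrow> 'a set" where
  "uverts \<Gamma> \<equiv> fst \<Gamma>"

abbreviation uedges :: "'a ugraph \<Rightarrow> 'a set set" where
  "uedges \<Gamma> \<equiv> snd \<Gamma>"

definition graph_complement :: "'a ugraph \<Rightarrow> 'a ugraph" where
  "graph_complement \<Gamma> =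
    (uverts \<Gamma>,
     {{x, y} | x y. x \<in> uverts \<Gamma> \<and> y \<in> uverts \<Gamma> \<and> x \<noteq> y \<and> {x, y} \<notin> uedges \<Gamma>})"

definition bipartite :: "'a ugraph \<Rightarrow> bool" where
  "bipartite \<Gamma> \<longleftrightarrow>
    (\<exists>A B. A \<union> B = uverts \<Gamma> \<and> A \<inter> B = {} \<and> indep A (uedges \<Gamma>) \<and> indep B (uedges \<Gamma>))"

text \<open>
  A cycle is given by its distinct vertices in cyclic order; the starting vertex is not repeated
  at the end, so the length of the cycle is the length of the list.
\<close>

definition is_cycle :: "'a ugraph \<Rightarrow> 'a list \<Rightarrow> bool" where
  "is_cycle \<Gamma> p \<longleftrightarrow>
    3 \<le> length p \<and> distinct p \<and> set p \<subseteq> uverts \<Gamma> \<and>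
    (\<forall>i < length p. {p ! i, p ! (Suc i mod length p)} \<in> uedges \<Gamma>)"

text \<open>The infimum of the empty set is \<open>\<infinity>\<close> in \<^typ>\<open>enat\<close>.\<close>

definition girth :: "'a ugraph \<Rightarrow> enat" where
  "girth \<Gamma> = (INF p \<in> {p. is_cycle \<Gamma> p}. enat (length p))"

text \<open>
  Clique and chromatic number take values in \<^typ>\<open>enat\<close>, so that they are meaningful for
  infinite graphs as well, all infinite cardinalities being identified with \<open>\<infinity>\<close>.
\<close>

definition clique_number :: "'a ugraph \<Rightarrow> enat" where
  "clique_number \<Gamma> =
    (SUP K \<in> {K. K \<subseteq> uverts \<Gamma> \<and> finite K \<and> clique K (uedges \<Gamma>)}. enat (card K))"

definition proper_colouring :: "'a ugraph \<Rightarrow> nat \<Rightarrow> ('a \<Rightarrow> nat) \<Rightarrow> bool" where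
  "proper_colouring \<Gamma> k c \<longleftrightarrow>
    (\<forall>x \<in> uverts \<Gamma>. c x < k) \<and>
    (\<forall>x \<in> uverts \<Gamma>. \<forall>y \<in> uverts \<Gamma>. {x, y} \<in> uedges \<Gamma> \<longrightarrow> c x \<noteq> c y)"

definition chromatic_number :: "'a ugraph \<Rightarrow> enat" where
  "chromatic_number \<Gamma> = (INF k \<in> {k. \<exists>c. proper_colouring \<Gamma> k c}. enat k)"

definition weakly_perfect :: "'a ugraph \<Rightarrow> bool" where
  "weakly_perfect \<Gamma> \<longleftrightarrow> clique_number \<Gamma> = chromatic_number \<Gamma>"

definition enhanced_power_graph :: "('a, 'b) monoid_scheme \<Rightarrow> 'a ugraph" where
  "enhanced_power_graph G =
    (carrier G,
     {{x, y} | x y. x \<in> carrier G \<and> y \<in> carrier G \<and> x \<noteq> y \<and>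
        (\<exists>z \<in> carrier G. x \<in> generate G {z} \<and> y \<in> generate G {z})})"

end

theory Submission
  imports Defs
begin

text \<open>
  The non-edges of the complement are the pairs lying in a common cyclic subgroup, so the
  statement is about how the cyclic subgroups cover \<open>G\<close>.

  Parts (i) and (ii) rest on one remark: if \<open>x\<close> and \<open>y\<close> are adjacent in the complement, then
  \<open>x\<close>, \<open>y\<close> and \<open>x y\<close> form a triangle there, because a subgroup containing two of these three
  elements contains the third (\<open>edge_in_triangle\<close>). Hence the complement is either edgeless,
  which makes it bipartite of infinite girth, or contains a triangle, which makes it
  non-bipartite of girth 3. In a finite group it is edgeless exactly when the group is cyclic
  (\<open>cyclic_iff_all_cocyclic\<close>): if every pair lies in a common cyclic subgroup, a maximal
  cyclic subgroup must absorb every element.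

  For part (iii), both numbers count the maximal cyclic subgroups. Generators of distinct
  maximal cyclic subgroups lie in no common cyclic subgroup, so one generator of each gives a
  clique; colouring every element by a maximal cyclic subgroup that contains it is proper.
\<close>

section \<open>Bipartite graphs, girth and weak perfection\<close>

lemma triangle_imp_not_bipartite:
  assumes tri: "{x, y} \<in> uedges \<Gamma>" "{y, z} \<in> uedges \<Gamma>" "{z, x} \<in> uedges \<Gamma>"
    and distinct: "x \<noteq> y" "y \<noteq> z" "z \<noteq> x"
    and verts: "x \<in> uverts \<Gamma>" "y \<in> uverts \<Gamma>" "z \<in> uverts \<Gamma>"
  shows "\<not> bipartite \<Gamma>"
proof
  assume "bipartite \<Gamma>"
  then obtain A B where AB: "A \<union> B = uverts \<Gamma>"
      and indep: "indep A (uedges \<Gamma>)" "indep B (uedges \<Gamma>)"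
    unfolding bipartite_def by blast
  have "x \<in> A \<or> x \<in> B" "y \<in> A \<or> y \<in> B" "z \<in> A \<or> z \<in> B"
    using verts AB by blast+
  moreover have "\<not> (u \<in> A \<and> v \<in> A)" "\<not> (u \<in> B \<and> v \<in> B)"
    if "{u, v} \<in> uedges \<Gamma>" "u \<noteq> v" for u v
    using indep that unfolding indep_def by blast+
  ultimately show False
    using tri distinct by blast
qed

lemma triangle_imp_girth_3:
  assumes tri: "{x, y} \<in> uedges \<Gamma>" "{y, z} \<in> uedges \<Gamma>" "{z, x} \<in> uedges \<Gamma>"
    and distinct: "x \<noteq> y" "y \<noteq> z" "z \<noteq> x"
    and verts: "x \<in> uverts \<Gamma>" "y \<in> uverts \<Gamma>" "z \<in> uverts \<Gamma>"
  shows "girth \<Gamma> = 3"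
proof -
  have "{[x, y, z] ! i, [x, y, z] ! (Suc i mod length [x, y, z])} \<in> uedges \<Gamma>"
    if "i < length [x, y, z]" for i
  proof -
    from that consider "i = 0" | "i = 1" | "i = 2" by fastforce
    then show ?thesis by cases (simp_all add: tri)
  qed
  then have "is_cycle \<Gamma> [x, y, z]"
    using distinct verts unfolding is_cycle_def by auto
  then have "girth \<Gamma> \<le> enat (length [x, y, z])"
    unfolding girth_def by (intro INF_lower) simp
  moreover have "3 \<le> girth \<Gamma>"
    unfolding girth_def is_cycle_def
    by (intro INF_greatest) (auto simp: numeral_eq_enat)
  ultimately show ?thesis
    by (intro antisym) (simp_all add: numeral_eq_enat eval_nat_numeral)
qed

lemma edgeless_imp_bipartite: "uedges \<Gamma> = {} \<Longrightarrow> bipartite \<Gamma>"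
  unfolding bipartite_def indep_def by (intro exI[of _ "uverts \<Gamma>"] exI[of _ "{}"]) simp

lemma edgeless_imp_girth_infinite:
  assumes "uedges \<Gamma> = {}"
  shows "girth \<Gamma> = \<infinity>"
proof -
  have "\<not> is_cycle \<Gamma> p" for p
  proof
    assume "is_cycle \<Gamma> p"
    then have "3 \<le> length p" "\<forall>i < length p. {p ! i, p ! (Suc i mod length p)} \<in> uedges \<Gamma>"
      unfolding is_cycle_def by blast+
    then have "{p ! 0, p ! (Suc 0 mod length p)} \<in> uedges \<Gamma>"
      by fastforce
    with assms show False by simp
  qed
  then have "{p. is_cycle \<Gamma> p} = {}" by blast
  then show ?thesis
    unfolding girth_def by (simp only: image_empty Inf_empty top_enat_def)
qed

lemma card_clique_le_colours:
  assumes "K \<subseteq> uverts \<Gamma>" "clique K (uedges \<Gamma>)" "proper_colouring \<Gamma> k c"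
  shows "card K \<le> k"
proof -
  have "inj_on c K"
    using assms unfolding inj_on_def clique_def proper_colouring_def by blast
  moreover have "c ` K \<subseteq> {..<k}"
    using assms unfolding proper_colouring_def by blast
  ultimately show ?thesis
    using card_inj_on_le[of c K "{..<k}"] by simp
qed

text \<open>
  Every colouring needs at least as many colours as any clique has vertices, so a clique and a
  colouring of the same size certify that both are optimal.
\<close>

lemma weakly_perfectI:
  assumes K: "K \<subseteq> uverts \<Gamma>" "finite K" "clique K (uedges \<Gamma>)"
    and c: "proper_colouring \<Gamma> (card K) c"
  shows "weakly_perfect \<Gamma>"
proof -
  have "clique_number \<Gamma> \<le> chromatic_number \<Gamma>"
    unfolding clique_number_def chromatic_number_def
    by (intro SUP_least INF_greatest) (auto intro: card_clique_le_colours)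
  moreover have "chromatic_number \<Gamma> \<le> enat (card K)"
    unfolding chromatic_number_def using c by (intro INF_lower) blast
  moreover have "enat (card K) \<le> clique_number \<Gamma>"
    unfolding clique_number_def using K by (intro SUP_upper) blast
  ultimately show ?thesis
    unfolding weakly_perfect_def by order
qed

section \<open>Maximal cyclic subgroups\<close>

definition cyclic_subgroups :: "('a, 'b) monoid_scheme \<Rightarrow> 'a set set" where
  "cyclic_subgroups G = (\<lambda>z. generate G {z}) ` carrier G"

definition maximal_cyclic_subgroups :: "('a, 'b) monoid_scheme \<Rightarrow> 'a set set" where
  "maximal_cyclic_subgroups G =
    {M \<in> cyclic_subgroups G. \<forall>C \<in> cyclic_subgroups G. M \<subseteq> C \<longrightarrow> C = M}"

definition cocyclic :: "('a, 'b) monoid_scheme \<Rightarrow> 'a \<Rightarrow> 'a \<Rightarrow> bool" where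
  "cocyclic G x y \<longleftrightarrow> (\<exists>C \<in> cyclic_subgroups G. x \<in> C \<and> y \<in> C)"

context group
begin

lemma subgroup_cyclic: "C \<in> cyclic_subgroups G \<Longrightarrow> subgroup C G"
  unfolding cyclic_subgroups_def by (auto intro: generate_is_subgroup)

lemma cocyclic_refl: "x \<in> carrier G \<Longrightarrow> cocyclic G x x"
  unfolding cocyclic_def cyclic_subgroups_def by (auto intro: generate.incl)

lemma cocyclic_commute: "cocyclic G x y \<longleftrightarrow> cocyclic G y x"
  unfolding cocyclic_def by blast

lemma cocyclic_mult_imp:
  assumes "x \<in> carrier G" "y \<in> carrier G"
  shows "cocyclic G x (x \<otimes> y) \<Longrightarrow> cocyclic G x y"
    and "cocyclic G y (x \<otimes> y) \<Longrightarrow> cocyclic G x y"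
proof -
  assume "cocyclic G x (x \<otimes> y)"
  then obtain C where C: "C \<in> cyclic_subgroups G" "x \<in> C" "x \<otimes> y \<in> C"
    unfolding cocyclic_def by blast
  then interpret C: subgroup C G by (simp add: subgroup_cyclic)
  have "inv x \<otimes> (x \<otimes> y) \<in> C" using C by blast
  then have "y \<in> C" using assms by (simp add: m_assoc[symmetric])
  with C show "cocyclic G x y" unfolding cocyclic_def by blast
next
  assume "cocyclic G y (x \<otimes> y)"
  then obtain C where C: "C \<in> cyclic_subgroups G" "y \<in> C" "x \<otimes> y \<in> C"
    unfolding cocyclic_def by blast
  then interpret C: subgroup C G by (simp add: subgroup_cyclic)
  have "(x \<otimes> y) \<otimes> inv y \<in> C" using C by blast
  then have "x \<in> C" using assms by (simp add: m_assoc)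
  with C show "cocyclic G x y" unfolding cocyclic_def by blast
qed

lemma cyclic_subgroup_le_maximal:
  assumes "finite (carrier G)" "C \<in> cyclic_subgroups G"
  obtains M where "M \<in> maximal_cyclic_subgroups G" "C \<subseteq> M"
proof -
  have "finite (cyclic_subgroups G)"
    using assms(1) unfolding cyclic_subgroups_def by simp
  from finite_has_maximal2[OF this assms(2)]
  obtain M where M: "M \<in> cyclic_subgroups G" "C \<subseteq> M"
    and max: "\<forall>D \<in> cyclic_subgroups G. M \<subseteq> D \<longrightarrow> M = D"
    by blast
  then have "M \<in> maximal_cyclic_subgroups G"
    unfolding maximal_cyclic_subgroups_def by auto
  with M(2) show ?thesis by (rule that[rotated])
qed

lemma in_maximal_cyclic_subgroup:
  assumes "finite (carrier G)" "x \<in> carrier G"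
  obtains M where "M \<in> maximal_cyclic_subgroups G" "x \<in> M"
proof -
  have "generate G {x} \<in> cyclic_subgroups G"
    using assms(2) unfolding cyclic_subgroups_def by blast
  with assms(1) obtain M where "M \<in> maximal_cyclic_subgroups G" "generate G {x} \<subseteq> M"
    by (rule cyclic_subgroup_le_maximal)
  with that show ?thesis by (blast intro: generate.incl)
qed

text \<open>
  A cyclic subgroup witnessing that \<open>x\<close> and \<open>y\<close> are cocyclic contains all of
  \<^term>\<open>generate G {x}\<close>, and so equals it by maximality.
\<close>

lemma cocyclic_generator_of_maximal:
  assumes "generate G {x} \<in> maximal_cyclic_subgroups G" "cocyclic G x y"
  shows "y \<in> generate G {x}"
proof -
  obtain C where C: "C \<in> cyclic_subgroups G" "x \<in> C" "y \<in> C"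
    using assms(2) unfolding cocyclic_def by blast
  then have "generate G {x} \<subseteq> C"
    by (intro generate_subgroup_incl subgroup_cyclic) simp_all
  with assms(1) C show ?thesis
    unfolding maximal_cyclic_subgroups_def by blast
qed

lemma cyclic_group_iff_carrier_cyclic:
  "cyclic_group G \<longleftrightarrow> carrier G \<in> cyclic_subgroups G"
proof -
  have "subgroup_generated G {x} = G \<longleftrightarrow> carrier G = generate G {x}" if "x \<in> carrier G" for x
  proof -
    have "subgroup_generated G {x} = G\<lparr>carrier := generate G {x}\<rparr>"
      using that by (simp add: subgroup_generated_def)
    then show ?thesis
      by (metis partial_object.surjective partial_object.update_convs(1) partial_object.select_convs(1))
  qed
  then show ?thesis
    unfolding cyclic_group_def cyclic_subgroups_def by blast
qed

lemma cyclic_iff_all_cocyclic: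
  assumes "finite (carrier G)"
  shows "cyclic_group G \<longleftrightarrow> (\<forall>x \<in> carrier G. \<forall>y \<in> carrier G. cocyclic G x y)"
proof
  assume "cyclic_group G"
  then show "\<forall>x \<in> carrier G. \<forall>y \<in> carrier G. cocyclic G x y"
    unfolding cyclic_group_iff_carrier_cyclic cocyclic_def by blast
next
  assume all: "\<forall>x \<in> carrier G. \<forall>y \<in> carrier G. cocyclic G x y"
  obtain M where M: "M \<in> maximal_cyclic_subgroups G"
    using in_maximal_cyclic_subgroup[OF assms one_closed] .
  then have "M \<in> cyclic_subgroups G"
    unfolding maximal_cyclic_subgroups_def by blast
  then obtain x where x: "x \<in> carrier G" "M = generate G {x}"
    unfolding cyclic_subgroups_def by blast
  have "carrier G \<subseteq> M"
    using cocyclic_generator_of_maximal all M x by blast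
  moreover have "M \<subseteq> carrier G"
    using \<open>M \<in> cyclic_subgroups G\<close> by (intro subgroup.subset subgroup_cyclic)
  ultimately show "cyclic_group G"
    using \<open>M \<in> cyclic_subgroups G\<close> unfolding cyclic_group_iff_carrier_cyclic by simp
qed

end

section \<open>The complement of the enhanced power graph\<close>

abbreviation noncocyclic_graph :: "('a, 'b) monoid_scheme \<Rightarrow> 'a ugraph" where
  "noncocyclic_graph G \<equiv> graph_complement (enhanced_power_graph G)"

context group
begin

lemma uverts_noncocyclic_graph: "uverts (noncocyclic_graph G) = carrier G"
  unfolding graph_complement_def enhanced_power_graph_def by simp

text \<open>
  Distinctness of \<open>x\<close> and \<open>y\<close> does not appear on the right because every element is cocyclic
  with itself.
\<close>

lemma edge_noncocyclic_graph_iff: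
  assumes "x \<in> carrier G" "y \<in> carrier G"
  shows "{x, y} \<in> uedges (noncocyclic_graph G) \<longleftrightarrow> \<not> cocyclic G x y"
proof -
  have "{x, y} \<in> uedges (enhanced_power_graph G) \<longleftrightarrow> x \<noteq> y \<and> cocyclic G x y"
    using assms unfolding enhanced_power_graph_def cocyclic_def cyclic_subgroups_def
    by (auto simp: doubleton_eq_iff)
  moreover have "{x, y} \<in> uedges (noncocyclic_graph G) \<longleftrightarrow>
      x \<noteq> y \<and> {x, y} \<notin> uedges (enhanced_power_graph G)"
    using assms unfolding graph_complement_def enhanced_power_graph_def
    by (auto simp: doubleton_eq_iff)
  ultimately show ?thesis
    using assms cocyclic_refl by auto
qed

lemma noncocyclic_graph_edgeless_iff:
  "uedges (noncocyclic_graph G) = {} \<longleftrightarrow> (\<forall>x \<in> carrier G. \<forall>y \<in> carrier G. cocyclic G x y)"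
proof -
  have "\<exists>x \<in> carrier G. \<exists>y \<in> carrier G. e = {x, y}" if "e \<in> uedges (noncocyclic_graph G)" for e
    using that unfolding graph_complement_def enhanced_power_graph_def by auto
  then have "uedges (noncocyclic_graph G) = {} \<longleftrightarrow>
      (\<forall>x \<in> carrier G. \<forall>y \<in> carrier G. {x, y} \<notin> uedges (noncocyclic_graph G))"
    by blast
  then show ?thesis
    by (simp add: edge_noncocyclic_graph_iff)
qed

text \<open>
  The third vertex is the product: a subgroup containing it and one of its factors contains the
  other factor.
\<close>

lemma edge_in_triangle:
  assumes "x \<in> carrier G" "y \<in> carrier G" "\<not> cocyclic G x y"
  shows "{x, y} \<in> uedges (noncocyclic_graph G)"
    "{y, x \<otimes> y} \<in> uedges (noncocyclic_graph G)"
    "{x \<otimes> y, x} \<in> uedges (noncocyclic_graph G)"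
    "x \<noteq> y" "y \<noteq> x \<otimes> y" "x \<otimes> y \<noteq> x"
proof -
  have not_cocyclic: "\<not> cocyclic G y (x \<otimes> y)" "\<not> cocyclic G (x \<otimes> y) x"
    using assms cocyclic_mult_imp cocyclic_commute by blast+
  show "{x, y} \<in> uedges (noncocyclic_graph G)"
    "{y, x \<otimes> y} \<in> uedges (noncocyclic_graph G)"
    "{x \<otimes> y, x} \<in> uedges (noncocyclic_graph G)"
    using assms not_cocyclic by (simp_all add: edge_noncocyclic_graph_iff)
  show "x \<noteq> y" "y \<noteq> x \<otimes> y" "x \<otimes> y \<noteq> x"
    using assms not_cocyclic cocyclic_refl by metis+
qed

lemma weakly_perfect_noncocyclic_graph:
  assumes fin: "finite (carrier G)"
  shows "weakly_perfect (noncocyclic_graph G)"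
proof -
  let ?\<M> = "maximal_cyclic_subgroups G"
  have "\<forall>M \<in> ?\<M>. \<exists>x \<in> carrier G. generate G {x} = M"
    unfolding maximal_cyclic_subgroups_def cyclic_subgroups_def by blast
  then obtain g where g: "\<And>M. M \<in> ?\<M> \<Longrightarrow> g M \<in> carrier G"
      "\<And>M. M \<in> ?\<M> \<Longrightarrow> generate G {g M} = M"
    by metis
  have "\<forall>x \<in> carrier G. \<exists>M \<in> ?\<M>. x \<in> M"
    using in_maximal_cyclic_subgroup[OF fin] by metis
  then obtain m where m: "\<And>x. x \<in> carrier G \<Longrightarrow> m x \<in> ?\<M>" "\<And>x. x \<in> carrier G \<Longrightarrow> x \<in> m x"
    by metis
  have fin\<M>: "finite ?\<M>"
    using fin unfolding maximal_cyclic_subgroups_def cyclic_subgroups_def by simp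
  obtain num where num: "bij_betw num ?\<M> {..<card ?\<M>}"
    using ex_bij_betw_finite_nat[OF fin\<M>] by (auto simp: atLeast0LessThan)
  have inj: "inj_on g ?\<M>"
    using g(2) by (metis inj_onI)
  show ?thesis
  proof (rule weakly_perfectI)
    show "g ` ?\<M> \<subseteq> uverts (noncocyclic_graph G)"
      using g(1) by (auto simp: uverts_noncocyclic_graph)
    show "finite (g ` ?\<M>)"
      using fin\<M> by simp
    have "M = N" if "M \<in> ?\<M>" "N \<in> ?\<M>" "cocyclic G (g M) (g N)" for M N
    proof -
      have "g N \<in> M"
        using cocyclic_generator_of_maximal[of "g M" "g N"] that g(2) by simp
      moreover have "M \<in> cyclic_subgroups G"
        using that unfolding maximal_cyclic_subgroups_def by blast
      ultimately have "N \<subseteq> M"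
        using generate_subgroup_incl[of "{g N}" M] subgroup_cyclic g(2) that by simp
      with that show ?thesis
        unfolding maximal_cyclic_subgroups_def by blast
    qed
    then show "clique (g ` ?\<M>) (uedges (noncocyclic_graph G))"
      unfolding clique_def using edge_noncocyclic_graph_iff g(1) by blast
    have colour: "num (m x) \<noteq> num (m y)"
      if "x \<in> carrier G" "y \<in> carrier G" "\<not> cocyclic G x y" for x y
    proof
      assume "num (m x) = num (m y)"
      then have "m x = m y"
        using num m(1) that by (metis bij_betw_imp_inj_on inj_onD)
      then have "x \<in> m x" "y \<in> m x" "m x \<in> cyclic_subgroups G"
        using m that unfolding maximal_cyclic_subgroups_def by auto
      with that show False
        unfolding cocyclic_def by blast
    qed
    have "num (m x) < card (g ` ?\<M>)" if "x \<in> carrier G" for x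
      using bij_betwE[OF num] m(1)[OF that] by (simp add: card_image[OF inj])
    with colour show "proper_colouring (noncocyclic_graph G) (card (g ` ?\<M>)) (\<lambda>x. num (m x))"
      unfolding proper_colouring_def uverts_noncocyclic_graph
      by (simp add: edge_noncocyclic_graph_iff)
  qed
qed

end

theorem theorem3p3:
  fixes G :: "('a, 'b) monoid_scheme"
  assumes "group G" and "finite (carrier G)"
  shows "(bipartite (graph_complement (enhanced_power_graph G)) \<longleftrightarrow> cyclic_group G)
       \<and> (girth (graph_complement (enhanced_power_graph G)) = 3 \<or>
          girth (graph_complement (enhanced_power_graph G)) = \<infinity>)
       \<and> weakly_perfect (graph_complement (enhanced_power_graph G))"
proof -
  interpret group G by fact
  have "(bipartite (noncocyclic_graph G) \<longleftrightarrow> cyclic_group G) \<and>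
      (girth (noncocyclic_graph G) = 3 \<or> girth (noncocyclic_graph G) = \<infinity>)"
  proof (cases "cyclic_group G")
    case True
    then have "uedges (noncocyclic_graph G) = {}"
      using cyclic_iff_all_cocyclic[OF assms(2)] noncocyclic_graph_edgeless_iff by simp
    with True show ?thesis
      by (simp add: edgeless_imp_bipartite edgeless_imp_girth_infinite)
  next
    case False
    then obtain x y where xy: "x \<in> carrier G" "y \<in> carrier G" "\<not> cocyclic G x y"
      using cyclic_iff_all_cocyclic[OF assms(2)] by blast
    then have "x \<in> uverts (noncocyclic_graph G)" "y \<in> uverts (noncocyclic_graph G)"
        "x \<otimes>\<^bsub>G\<^esub> y \<in> uverts (noncocyclic_graph G)"
      by (simp_all add: uverts_noncocyclic_graph)
    note triangle = edge_in_triangle[OF xy] this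
    have "\<not> bipartite (noncocyclic_graph G)" "girth (noncocyclic_graph G) = 3"
      by (rule triangle_imp_not_bipartite[OF triangle], rule triangle_imp_girth_3[OF triangle])
    with False show ?thesis by simp
  qed
  then show ?thesis
    using weakly_perfect_noncocyclic_graph[OF assms(2)] by simp
qed

end
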